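(* Every elliptic quasi-$1$-plane is a bounded morphic image of a non-degenerate elliptic $1$-plane; that is, for every elliptic quasi-$1$-plane $\mathscr{F}'$ there exist a non-degenerate elliptic $1$-plane $\mathscr{F}$ and a surjective bounded morphism $\theta:\mathscr{F}\to\mathscr{F}'$.
   Context: A $1$-frame is a pair $(X,I)$ with $I\subseteq X\times X$; $I^2$ is the composition of $I$ with itself. An elliptic quasi-$1$-plane is a $1$-frame in which $I$ is symmetric and which satisfies O5: for all $a,b$, $aI^2b$. An elliptic $1$-plane is a $1$-frame satisfying O5 and O3: $aIbIcIdIa$ implies $a=c$ or $b=d$. It is non-degenerate if it satisfies O4$'$: there exist $a,b,c,d$ with $aIbIcId$, $a\neq c$, $b\neq d$, and neither $aIc$ nor $bId$. A bounded morphism from $(X,I)$ to $(X',I')$ is a function $\theta:X\to X'$ such that $aIb$ implies $\theta(a)I'\theta(b)$, and whenever $\theta(a)I'b'$ there exists $b\in X$ with $aIb$ and $\theta(b)=b'$. *)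

theory Defs
  imports Main "HOL-Library.FuncSet"
begin

text \<open>A 1-frame \<open>(X, I)\<close> is given by a carrier \<open>X\<close> and a set \<open>I\<close> of pairs.
  As usual for Kripke frames, carriers are nonempty. This is needed: the empty frame would be
  an elliptic quasi-1-plane, but no non-degenerate plane maps into it.\<close>

definition one_frame :: "'a set \<Rightarrow> ('a \<times> 'a) set \<Rightarrow> bool" where
  "one_frame X I \<longleftrightarrow> X \<noteq> {} \<and> I \<subseteq> X \<times> X"

definition axiom_O5 :: "'a set \<Rightarrow> ('a \<times> 'a) set \<Rightarrow> bool" where
  "axiom_O5 X I \<longleftrightarrow> (\<forall>a\<in>X. \<forall>b\<in>X. (a, b) \<in> I O I)"

definition axiom_O3 :: "'a set \<Rightarrow> ('a \<times> 'a) set \<Rightarrow> bool" where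
  "axiom_O3 X I \<longleftrightarrow> (\<forall>a\<in>X. \<forall>b\<in>X. \<forall>c\<in>X. \<forall>d\<in>X.
     (a, b) \<in> I \<and> (b, c) \<in> I \<and> (c, d) \<in> I \<and> (d, a) \<in> I \<longrightarrow> a = c \<or> b = d)"

definition axiom_O4' :: "'a set \<Rightarrow> ('a \<times> 'a) set \<Rightarrow> bool" where
  "axiom_O4' X I \<longleftrightarrow> (\<exists>a\<in>X. \<exists>b\<in>X. \<exists>c\<in>X. \<exists>d\<in>X.
     (a, b) \<in> I \<and> (b, c) \<in> I \<and> (c, d) \<in> I \<and> a \<noteq> c \<and> b \<noteq> d \<and> (a, c) \<notin> I \<and> (b, d) \<notin> I)"

definition elliptic_quasi_1_plane :: "'a set \<Rightarrow> ('a \<times> 'a) set \<Rightarrow> bool" where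
  "elliptic_quasi_1_plane X I \<longleftrightarrow> one_frame X I \<and> sym I \<and> axiom_O5 X I"

definition elliptic_1_plane :: "'a set \<Rightarrow> ('a \<times> 'a) set \<Rightarrow> bool" where
  "elliptic_1_plane X I \<longleftrightarrow> one_frame X I \<and> axiom_O5 X I \<and> axiom_O3 X I"

definition nondegenerate_elliptic_1_plane :: "'a set \<Rightarrow> ('a \<times> 'a) set \<Rightarrow> bool" where
  "nondegenerate_elliptic_1_plane X I \<longleftrightarrow> elliptic_1_plane X I \<and> axiom_O4' X I"

text \<open>Symmetry is not an axiom of elliptic 1-planes because it follows from O3 and O5.\<close>

lemma elliptic_1_plane_sym:
  assumes "elliptic_1_plane X I"
  shows "sym I"
proof (rule symI)
  fix a b assume ab: "(a, b) \<in> I"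
  have sub: "I \<subseteq> X \<times> X" and O5: "axiom_O5 X I" and O3: "axiom_O3 X I"
    using assms by (auto simp: elliptic_1_plane_def one_frame_def)
  from ab sub have X: "a \<in> X" "b \<in> X" by auto
  from O5 X obtain z where za: "(z, a) \<in> I" unfolding axiom_O5_def by blast
  with sub have zX: "z \<in> X" by auto
  with O5 X obtain w where bw: "(b, w) \<in> I" and wz: "(w, z) \<in> I"
    unfolding axiom_O5_def by blast
  with sub have wX: "w \<in> X" by auto
  have "b = z \<or> w = a"
    using O3 X zX wX bw wz za ab unfolding axiom_O3_def by blast
  with za bw show "(b, a) \<in> I" by blast
qed

definition bounded_morphism ::
    "'a set \<Rightarrow> ('a \<times> 'a) set \<Rightarrow> 'b set \<Rightarrow> ('b \<times> 'b) set \<Rightarrow> ('a \<Rightarrow> 'b) \<Rightarrow> bool" where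
  "bounded_morphism X I X' I' \<theta> \<longleftrightarrow>
     \<theta> \<in> X \<rightarrow> X' \<and>
     (\<forall>a\<in>X. \<forall>b\<in>X. (a, b) \<in> I \<longrightarrow> (\<theta> a, \<theta> b) \<in> I') \<and>
     (\<forall>a\<in>X. \<forall>b'\<in>X'. (\<theta> a, b') \<in> I' \<longrightarrow> (\<exists>b\<in>X. (a, b) \<in> I \<and> \<theta> b = b'))"

text \<open>HOL cannot quantify existentially over types, so the theorem has to name a type
  in which the carrier of the covering plane lives. The type \<open>('a \<times> nat) list\<close> has
  cardinality \<open>max |'a| \<aleph>\<^sub>0\<close>, so it contains a copy of every countable
  frame and of every frame no larger than the type \<open>'a\<close> of the given one.\<close>

end

theory Submission
  imports Defs
begin

text \<open>The plane is built freely in countably many stages from a single point, without loops.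
  At stage \<open>n\<close> every point receives a new neighbour over each \<open>I'\<close>-neighbour of its label,
  and every two distinct points without a common neighbour so far receive exactly one, labelled by
  a common neighbour of their labels, which O5 provides. A new point is adjacent only to the one or
  two points it was created for, so a vertex of maximal stage in a 4-cycle would join two points
  that were already joined, or that were joined twice at the same stage.\<close>

text \<open>\<open>New n p q x\<close> is the point labelled \<open>x\<close> added at stage \<open>n\<close> for the
  pair \<open>p\<close>, \<open>q\<close>; the case \<open>p = q\<close> is that of a pendant neighbour.\<close>

datatype 'a point = Base 'a | New nat "'a point" "'a point" 'a

primrec label :: "'a point \<Rightarrow> 'a" where
  "label (Base x) = x"
| "label (New n p q x) = x"

primrec level :: "'a point \<Rightarrow> nat" where
  "level (Base x) = 0"
| "level (New n p q x) = Suc n"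

primrec parents :: "'a point \<Rightarrow> 'a point set" where
  "parents (Base x) = {}"
| "parents (New n p q x) = {p, q}"

definition adj :: "'a point \<Rightarrow> 'a point \<Rightarrow> bool" where
  "adj p q \<longleftrightarrow> p \<in> parents q \<or> q \<in> parents p"

lemma adj_sym: "adj p q \<longleftrightarrow> adj q p"
  by (auto simp: adj_def)

section \<open>Coding points as lists\<close>

primrec encode :: "'a point \<Rightarrow> ('a \<times> nat) list" where
  "encode (Base x) = [(x, 0)]"
| "encode (New n p q x) = (x, Suc n) # encode p @ encode q"

text \<open>\<open>encode\<close> is Polish notation: the number in the head tells a leaf, 0, from a
  binary node, \<open>Suc n\<close>. The tails \<open>xs\<close> and \<open>ys\<close> let the
  induction peel off one subtree at a time.\<close>

lemma encode_prefix_free: "encode p @ xs = encode q @ ys \<Longrightarrow> p = q \<and> xs = ys"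
proof (induction p arbitrary: q xs ys)
  case (Base x)
  then show ?case by (cases q) auto
next
  case (New n p1 p2 x)
  show ?case
  proof (cases q)
    case (Base y)
    then show ?thesis using New.prems by simp
  next
    case q: (New m q1 q2 y)
    with New.prems have head: "x = y" "n = m"
      and "encode p1 @ (encode p2 @ xs) = encode q1 @ (encode q2 @ ys)" by auto
    from New.IH(1)[OF this(3)] have p1: "p1 = q1" and "encode p2 @ xs = encode q2 @ ys" by auto
    from New.IH(2)[OF this(2)] head p1 q show ?thesis by simp
  qed
qed

lemma inj_encode: "inj encode"
  by (rule injI) (metis encode_prefix_free)

lemma encode_eq_iff [simp]: "encode p = encode q \<longleftrightarrow> p = q"
  using inj_encode by (auto dest: injD)

lemma fst_hd_encode [simp]: "fst (hd (encode p)) = label p"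
  by (cases p) auto

text \<open>Selects one of the two orderings of each unordered pair, so that only one point is added
  for it.\<close>

definition canonical :: "'a \<Rightarrow> 'a \<Rightarrow> bool" where
  "canonical p q \<longleftrightarrow> (SOME z. {fst z, snd z} = {p, q}) = (p, q)"

lemma canonical_total: "canonical p q \<or> canonical q p"
proof -
  define z where "z = (SOME z. {fst z, snd z} = {p, q})"
  have "{fst z, snd z} = {p, q}"
    unfolding z_def by (rule someI[where x = "(p, q)"]) simp
  then have "z = (p, q) \<or> z = (q, p)"
    unfolding doubleton_eq_iff by (auto intro: prod_eqI)
  then show ?thesis
    unfolding canonical_def z_def insert_commute[of q p] .
qed

text \<open>The choice in \<open>canonical\<close> sees \<open>p\<close> and \<open>q\<close> only
  through the set \<open>{p, q}\<close>, so equal sets yield the same ordered pair.\<close>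

lemma canonical_unique:
  assumes "canonical p q" "canonical p' q'" "{p, q} = {p', q'}"
  shows "p = p' \<and> q = q'"
proof -
  have "(p, q) = (p', q')"
    using assms(1,2) unfolding canonical_def assms(3) by (rule trans[OF sym])
  then show ?thesis by simp
qed

section \<open>The staged construction\<close>

locale quasi_plane =
  fixes X' :: "'a set" and I' :: "('a \<times> 'a) set" and o' :: 'a
  assumes quasi: "elliptic_quasi_1_plane X' I'" and base: "o' \<in> X'"
begin

lemma I'_sub: "I' \<subseteq> X' \<times> X'" and I'_sym: "(x, y) \<in> I' \<Longrightarrow> (y, x) \<in> I'"
  and I'_O5: "x \<in> X' \<Longrightarrow> y \<in> X' \<Longrightarrow> \<exists>z. (x, z) \<in> I' \<and> (z, y) \<in> I'"
  using quasi unfolding elliptic_quasi_1_plane_def one_frame_def axiom_O5_def sym_def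
  by (simp, metis, blast)

text \<open>A fixed choice of common neighbour, so that a pair cannot receive two joining points
  with different labels at one stage.\<close>

definition mid :: "'a \<Rightarrow> 'a \<Rightarrow> 'a" where
  "mid x y = (SOME z. (x, z) \<in> I' \<and> (y, z) \<in> I')"

lemma mid:
  assumes "x \<in> X'" "y \<in> X'"
  shows "(x, mid x y) \<in> I'" "(y, mid x y) \<in> I'"
proof -
  have "\<exists>z. (x, z) \<in> I' \<and> (y, z) \<in> I'"
    using I'_O5[OF assms] I'_sym by blast
  from someI_ex[OF this] show "(x, mid x y) \<in> I'" "(y, mid x y) \<in> I'"
    unfolding mid_def by auto
qed

primrec stage :: "nat \<Rightarrow> 'a point set" where
  "stage 0 = {Base o'}"
| "stage (Suc n) = stage n \<union> {New n p q x | p q x.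
     p \<in> stage n \<and> q \<in> stage n \<and> (label p, x) \<in> I' \<and> (label q, x) \<in> I' \<and>
     (p = q \<or> canonical p q \<and> \<not> (\<exists>r\<in>stage n. adj p r \<and> adj q r) \<and> x = mid (label p) (label q))}"

definition points :: "'a point set" where
  "points = (\<Union>n. stage n)"

lemma stage_mono: "m \<le> n \<Longrightarrow> stage m \<subseteq> stage n"
  by (rule lift_Suc_mono_le[of stage]) auto

lemma stage_label: "p \<in> stage n \<Longrightarrow> label p \<in> X'"
  by (induction n arbitrary: p) (use base I'_sub in auto)

lemma stage_level: "p \<in> stage n \<Longrightarrow> level p \<le> n \<and> p \<in> stage (level p)"
proof (induction n arbitrary: p)
  case (Suc n)
  show ?case
  proof (cases "p \<in> stage n")
    case True
    then show ?thesis using Suc.IH by force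
  next
    case False
    then have "level p = Suc n" using Suc.prems by auto
    then show ?thesis using Suc.prems by simp
  qed
qed auto

lemma points_level: "p \<in> points \<Longrightarrow> level p \<le> n \<Longrightarrow> p \<in> stage n"
  unfolding points_def using stage_level stage_mono by blast

lemma points_label: "p \<in> points \<Longrightarrow> label p \<in> X'"
  unfolding points_def using stage_label by blast

text \<open>A point tagged \<open>n\<close> has level \<open>Suc n\<close>, so it enters at stage
  \<open>Suc n\<close> and not earlier; hence it satisfies the clause that adds new points.\<close>

lemma points_New:
  assumes "New n p q x \<in> points"
  shows "p \<in> stage n" "q \<in> stage n" "(label p, x) \<in> I'" "(label q, x) \<in> I'"
    "p = q \<or> canonical p q \<and> \<not> (\<exists>r\<in>stage n. adj p r \<and> adj q r) \<and> x = mid (label p) (label q)"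
proof -
  have "New n p q x \<in> stage (Suc n)"
    using points_level[OF assms, of "Suc n"] by simp
  moreover have "New n p q x \<notin> stage n"
    using stage_level by force
  ultimately show "p \<in> stage n" "q \<in> stage n" "(label p, x) \<in> I'" "(label q, x) \<in> I'"
    "p = q \<or> canonical p q \<and> \<not> (\<exists>r\<in>stage n. adj p r \<and> adj q r) \<and> x = mid (label p) (label q)"
    by auto
qed

lemma parents_level: "q \<in> points \<Longrightarrow> p \<in> parents q \<Longrightarrow> level p < level q"
  by (cases q) (use points_New(1,2) stage_level in \<open>force+\<close>)

text \<open>Of two adjacent points one is a parent of the other, and a parent has strictly smaller
  level.\<close>

lemma adj_parents:
  "p \<in> points \<Longrightarrow> adj p q \<Longrightarrow> level q \<le> level p \<Longrightarrow> q \<in> points \<Longrightarrow> q \<in> parents p"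
  unfolding adj_def using parents_level by fastforce

lemma adj_label:
  assumes "p \<in> points" "q \<in> points" "adj p q"
  shows "(label p, label q) \<in> I'"
proof -
  have *: "(label u, label v) \<in> I'" if "v \<in> points" "u \<in> parents v" for u v
    using that by (cases v) (auto dest: points_New)
  show ?thesis using assms * I'_sym unfolding adj_def by blast
qed

section \<open>Absence of 4-cycles\<close>

lemma no_square_aux:
  assumes pts: "a \<in> points" "b \<in> points" "c \<in> points" "d \<in> points"
    and adj: "adj a b" "adj b c" "adj c d" "adj d a"
    and max: "level b \<le> level a" "level c \<le> level a" "level d \<le> level a"
    and bd: "b \<noteq> d"
  shows "a = c"
proof -
  have par: "b \<in> parents a" "d \<in> parents a"
    using adj_parents pts adj max adj_sym by blast+
  then obtain n p q x where a: "a = New n p q x" by (cases a) auto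
  have pq: "{p, q} = {b, d}" using par bd a by auto
  have new: "New n p q x \<in> points" using pts a by simp
  have "p \<noteq> q" using pq bd by auto
  with points_New(5)[OF new] have can: "canonical p q"
    and none: "\<not> (\<exists>r\<in>stage n. adj p r \<and> adj q r)" and x: "x = mid (label p) (label q)" by auto
  have cbd: "adj p c" "adj q c" using pq adj adj_sym by (metis insert_iff singletonD)+
  \<comment> \<open>Had \<open>c\<close> been present at stage \<open>n\<close>, it would already
    have joined \<open>p\<close> and \<open>q\<close>, and \<open>a\<close> would not have been
    added.\<close>
  then have "c \<notin> stage n" using none by blast
  then have lc: "level c = Suc n"
    using points_level[OF pts(3), of n] max(2) a by fastforce
  then obtain p' q' x' where c: "c = New n p' q' x'" by (cases c) auto
  \<comment> \<open>Now \<open>c\<close> has maximal level too, so the argument given for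
    \<open>a\<close> applies to it.\<close>
  have "b \<in> parents c" "d \<in> parents c"
    using adj_parents[OF pts(3)] adj adj_sym pts max lc a by auto
  then have pq': "{p', q'} = {b, d}" using bd c by auto
  have new': "New n p' q' x' \<in> points" using pts c by simp
  have "p' \<noteq> q'" using pq' bd by auto
  with points_New(5)[OF new'] have "canonical p' q'" "x' = mid (label p') (label q')" by auto
  \<comment> \<open>Both points join the same unordered pair at the same stage;
    \<open>canonical\<close> fixes the order of the parents and \<open>mid\<close> then fixes the
    label.\<close>
  then show "a = c" using canonical_unique[OF can] pq pq' x a c by auto
qed

lemma no_square:
  assumes pts: "a \<in> points" "b \<in> points" "c \<in> points" "d \<in> points"
    and adj: "adj a b" "adj b c" "adj c d" "adj d a"
  shows "a = c \<or> b = d"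
proof -
  \<comment> \<open>Rotating the cycle brings a vertex of maximal level to the front.\<close>
  consider "level b \<le> level a" "level c \<le> level a" "level d \<le> level a"
    | "level a \<le> level b" "level c \<le> level b" "level d \<le> level b"
    | "level a \<le> level c" "level b \<le> level c" "level d \<le> level c"
    | "level a \<le> level d" "level b \<le> level d" "level c \<le> level d"
    by linarith
  then show ?thesis
    using no_square_aux[of a b c d] no_square_aux[of b c d a] no_square_aux[of c d a b]
      no_square_aux[of d a b c] pts adj
    by cases metis+
qed

section \<open>Neighbours over given labels and common neighbours\<close>

lemma pendant:
  assumes "p \<in> stage n" "(label p, x) \<in> I'"
  shows "New n p p x \<in> points" "adj p (New n p p x)"
proof -
  have "New n p p x \<in> stage (Suc n)" using assms by simp
  then show "New n p p x \<in> points" unfolding points_def by blast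
qed (simp add: adj_def)

lemma points_back:
  assumes "p \<in> points" "(label p, x) \<in> I'"
  shows "\<exists>q\<in>points. adj p q \<and> label q = x"
  using assms pendant unfolding points_def by (metis UN_E label.simps(2))

lemma joined:
  assumes "p \<in> points" "q \<in> points"
  shows "\<exists>r\<in>points. adj p r \<and> adj r q"
proof (cases "p = q")
  case True
  \<comment> \<open>O5 gives \<open>label p\<close> a neighbour in \<open>I'\<close>; a point over
    it adjacent to \<open>p\<close> leads from \<open>p\<close> back to \<open>p\<close>.\<close>
  then show ?thesis
    using points_back points_label[OF assms(1)] I'_O5 assms adj_sym by metis
next
  case False
  define n where "n = max (level p) (level q)"
  have st: "p \<in> stage n" "q \<in> stage n"
    using assms by (auto intro: points_level simp: n_def)
  show ?thesis
  proof (cases "\<exists>r\<in>stage n. adj p r \<and> adj q r")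
    case True
    then show ?thesis unfolding points_def using adj_sym by blast
  next
    case none: False
    have new: "New n u v (mid (label u) (label v)) \<in> points"
      if "u \<in> stage n" "v \<in> stage n" "canonical u v"
        "\<not> (\<exists>r\<in>stage n. adj u r \<and> adj v r)" for u v
    proof -
      have "New n u v (mid (label u) (label v)) \<in> stage (Suc n)"
        using that mid stage_label by auto
      then show ?thesis unfolding points_def by blast
    qed
    \<comment> \<open>Only a canonical order of the pair receives a joining point, but
      \<open>adj\<close> is symmetric, so either order suffices.\<close>
    from canonical_total[of p q] show ?thesis
    proof
      assume "canonical p q"
      from new[OF st this none] show ?thesis by (rule bexI[rotated]) (simp add: adj_def)
    next
      assume "canonical q p"
      from new[OF st(2,1) this] none show ?thesis
        by (intro bexI[of _ "New n q p (mid (label q) (label p))"]) (auto simp: adj_def)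
    qed
  qed
qed

section \<open>Non-degeneracy and surjectivity\<close>

lemma nondegenerate:
  "\<exists>a\<in>points. \<exists>b\<in>points. \<exists>c\<in>points. \<exists>d\<in>points.
     adj a b \<and> adj b c \<and> adj c d \<and> a \<noteq> c \<and> b \<noteq> d \<and> \<not> adj a c \<and> \<not> adj b d"
proof -
  obtain x where x: "(o', x) \<in> I'" using I'_O5 base by blast
  define b where "b = Base o'"
  \<comment> \<open>\<open>a\<close> and \<open>c\<close> are pendant neighbours of \<open>b\<close>
    with the same label, kept distinct by their stage tags. \<open>d\<close> hangs on
    \<open>c\<close> alone, and its label \<open>o'\<close> is allowed by symmetry of
    \<open>I'\<close>.\<close>
  define a where "a = New 0 b b x"
  define c where "c = New 1 b b x"
  define d where "d = New 2 c c o'"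
  have b0: "b \<in> stage 0" by (simp add: b_def)
  then have b1: "b \<in> stage 1" and b: "b \<in> points"
    unfolding points_def using stage_mono[of 0 1] by blast+
  have lx: "(label b, x) \<in> I'" using x by (simp add: b_def)
  have a: "a \<in> points" "adj b a" using pendant[OF b0 lx] by (auto simp: a_def)
  have c: "c \<in> points" "adj b c" using pendant[OF b1 lx] by (auto simp: c_def)
  have "c \<in> stage 2" using points_level[OF c(1)] by (simp add: c_def)
  then have d: "d \<in> points" "adj c d"
    using pendant[of c 2 o'] I'_sym[OF x] by (auto simp: c_def d_def)
  have "a \<noteq> c \<and> b \<noteq> d \<and> \<not> adj a c \<and> \<not> adj b d"
    by (simp add: adj_def a_def b_def c_def d_def)
  then show ?thesis using a b c d adj_sym by blast
qed

lemma label_surj: "label ` points = X'"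
proof
  show "label ` points \<subseteq> X'" using points_label by blast
  show "X' \<subseteq> label ` points"
  proof
    fix y assume "y \<in> X'"
    \<comment> \<open>By O5 every label is two steps from \<open>o'\<close>, and each step lifts to
      \<open>points\<close>.\<close>
    then obtain x where x: "(o', x) \<in> I'" "(x, y) \<in> I'" using I'_O5 base by blast
    have "Base o' \<in> stage 0" by simp
    then have "Base o' \<in> points" unfolding points_def by blast
    then obtain p where "p \<in> points" "label p = x"
      using points_back[of "Base o'" x] x by auto
    then show "y \<in> label ` points" using points_back x by blast
  qed
qed

section \<open>Transfer to lists\<close>

definition incidence :: "(('a \<times> nat) list \<times> ('a \<times> nat) list) set" where
  "incidence = {(encode p, encode q) | p q. p \<in> points \<and> q \<in> points \<and> adj p q}"

lemma incidence_iff [simp]: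
  "(encode p, encode q) \<in> incidence \<longleftrightarrow> p \<in> points \<and> q \<in> points \<and> adj p q"
  unfolding incidence_def by auto

lemma nondegenerate_plane: "nondegenerate_elliptic_1_plane (encode ` points) incidence"
proof -
  have "one_frame (encode ` points) incidence"
    unfolding one_frame_def incidence_def using nondegenerate by blast
  moreover have "axiom_O5 (encode ` points) incidence"
    unfolding axiom_O5_def
  proof (intro ballI; elim imageE; hypsubst)
    fix p q assume "p \<in> points" "q \<in> points"
    then obtain r where "(encode p, encode r) \<in> incidence" "(encode r, encode q) \<in> incidence"
      using joined by force
    then show "(encode p, encode q) \<in> incidence O incidence" by blast
  qed
  moreover have "axiom_O3 (encode ` points) incidence"
    unfolding axiom_O3_def using no_square by auto
  moreover have "axiom_O4' (encode ` points) incidence"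
    unfolding axiom_O4'_def using nondegenerate by simp
  ultimately show ?thesis
    unfolding nondegenerate_elliptic_1_plane_def elliptic_1_plane_def by blast
qed

lemma bounded_morphism_label:
  "bounded_morphism (encode ` points) incidence X' I' (fst \<circ> hd)"
  unfolding bounded_morphism_def
proof (intro conjI ballI impI; (elim imageE; hypsubst)?)
  show "fst \<circ> hd \<in> encode ` points \<rightarrow> X'" using points_label by auto
next
  fix p q assume "(encode p, encode q) \<in> incidence"
  then show "((fst \<circ> hd) (encode p), (fst \<circ> hd) (encode q)) \<in> I'"
    by (simp add: adj_label)
next
  fix y p assume "p \<in> points" "((fst \<circ> hd) (encode p), y) \<in> I'"
  then obtain q where "q \<in> points" "adj p q" "label q = y" using points_back by auto
  with \<open>p \<in> points\<close> show "\<exists>b\<in>encode ` points. (encode p, b) \<in> incidence \<and> (fst \<circ> hd) b = y"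
    by auto
qed

end

theorem theorem4p2:
  fixes X' :: "'a set" and I' :: "('a \<times> 'a) set"
  assumes "elliptic_quasi_1_plane X' I'"
  shows "\<exists>(X :: ('a \<times> nat) list set) I \<theta>.
           nondegenerate_elliptic_1_plane X I \<and>
           bounded_morphism X I X' I' \<theta> \<and>
           \<theta> ` X = X'"
proof -
  obtain b where "b \<in> X'"
    using assms unfolding elliptic_quasi_1_plane_def one_frame_def by blast
  \<comment> \<open>Any element of the nonempty carrier can label the starting point.\<close>
  with assms interpret quasi_plane X' I' b by unfold_locales
  have "(fst \<circ> hd) ` encode ` points = X'"
    using label_surj by (simp add: image_image)
  then show ?thesis
    using nondegenerate_plane bounded_morphism_label by blast
qed

end
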